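(* Fix integers $r > s\ge 0$ and let $n \to \infty$. Then $$\chi_{list}(G(n,r,s)) = O(n^{s+1}\log n),$$ where the implied constant may depend on $r$ and $s$.
   Context: $G(n,r,s)$ is the graph whose vertices are all $r$-element subsets of $[n]=\{1,\dots,n\}$, two vertices being adjacent if they intersect in exactly $s$ elements. The list chromatic number $\chi_{list}(G)$ of a graph $G$ is the minimal number $k$ such that for any assignment of sets $L(v)$, $v\in V(G)$, each of size $k$, there are colors $c(v)\in L(v)$ such that no edge of $G$ is monochromatic. *)

theory Defs
  imports Complex_Main "HOL-Library.Landau_Symbols"
begin

text \<open>A graph is a pair of its vertex set and its set of edges, each edge being the set of its
  two ends.\<close>

type_synonym 'a graph = "'a set \<times> 'a set set"

definition verts :: "'a graph \<Rightarrow> 'a set" where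
  "verts G = fst G"

definition edges :: "'a graph \<Rightarrow> 'a set set" where
  "edges G = snd G"

definition proper_colouring :: "'a graph \<Rightarrow> ('a \<Rightarrow> 'c) \<Rightarrow> bool" where
  "proper_colouring G c \<longleftrightarrow> (\<forall>u v. {u, v} \<in> edges G \<longrightarrow> c u \<noteq> c v)"

text \<open>Colours are natural numbers. For a finite graph this is no restriction: finitely many finite
  lists involve only finitely many colours. The finiteness condition on the lists matters for
  \<open>k = 0\<close> only, since an infinite set has \<open>card\<close> zero.\<close>

definition choosable :: "'a graph \<Rightarrow> nat \<Rightarrow> bool" where
  "choosable G k \<longleftrightarrow>
     (\<forall>L :: 'a \<Rightarrow> nat set.
        (\<forall>v \<in> verts G. finite (L v) \<and> card (L v) = k) \<longrightarrow>
        (\<exists>c. (\<forall>v \<in> verts G. c v \<in> L v) \<and> proper_colouring G c))"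

definition list_chromatic_number :: "'a graph \<Rightarrow> nat" where
  "list_chromatic_number G = (LEAST k. choosable G k)"

text \<open>For \<open>s < r\<close> adjacent vertices \<open>A\<close>, \<open>B\<close> are automatically distinct, so there are no loops.\<close>

definition intersection_graph :: "nat \<Rightarrow> nat \<Rightarrow> nat \<Rightarrow> nat set graph" where
  "intersection_graph n r s =
     ({A. A \<subseteq> {1..n} \<and> card A = r},
      {{A, B} | A B. A \<subseteq> {1..n} \<and> card A = r \<and> B \<subseteq> {1..n} \<and> card B = r \<and> card (A \<inter> B) = s})"

text \<open>The minimum in \<open>list_chromatic_number\<close> exists for every \<open>intersection_graph n r s\<close> with
  \<open>s < r\<close>: lists of size at least the number of vertices admit an injective choice of colours.\<close>

lemma injective_choice:
  fixes L :: "'a \<Rightarrow> 'c set"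
  assumes "finite V" "\<forall>v \<in> V. finite (L v) \<and> card V \<le> card (L v)"
  shows "\<exists>c. (\<forall>v \<in> V. c v \<in> L v) \<and> inj_on c V"
  using assms
proof (induction V rule: finite_induct)
  case empty
  then show ?case by simp
next
  case (insert x V)
  have "\<forall>v \<in> V. finite (L v) \<and> card V \<le> card (L v)"
    using insert by auto
  then obtain c where c: "\<forall>v \<in> V. c v \<in> L v" "inj_on c V"
    using insert.IH by blast
  have "card (c ` V) \<le> card V"
    using insert.hyps(1) by (rule card_image_le)
  moreover have "Suc (card V) \<le> card (L x)"
    using insert.prems insert.hyps by simp
  ultimately have "\<not> L x \<subseteq> c ` V"
    using card_mono[of "c ` V" "L x"] insert.hyps(1) by fastforce
  then obtain y where y: "y \<in> L x" "y \<notin> c ` V"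
    by blast
  have "(\<forall>v \<in> insert x V. (c(x := y)) v \<in> L v) \<and> inj_on (c(x := y)) (insert x V)"
    using c y insert.hyps(2) by (auto simp: inj_on_def)
  then show ?case by blast
qed

lemma choosable_list_chromatic_number:
  assumes "s < r"
  shows "choosable (intersection_graph n r s) (list_chromatic_number (intersection_graph n r s))"
proof -
  let ?G = "intersection_graph n r s"
  have fin: "finite (verts ?G)"
    by (simp add: verts_def intersection_graph_def)
  have proper: "proper_colouring ?G c" if inj: "inj_on c (verts ?G)" for c :: "nat set \<Rightarrow> nat"
    unfolding proper_colouring_def
  proof (intro allI impI)
    fix u v
    assume "{u, v} \<in> edges ?G"
    then have "u \<in> verts ?G" "v \<in> verts ?G" "card u = r" "card (u \<inter> v) = s"
      by (auto simp: edges_def verts_def intersection_graph_def doubleton_eq_iff Int_commute)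
    moreover from this have "u \<noteq> v"
      using assms by auto
    ultimately show "c u \<noteq> c v"
      using inj by (auto dest: inj_onD)
  qed
  have "choosable ?G (card (verts ?G))"
    unfolding choosable_def
  proof (intro allI impI)
    fix L :: "nat set \<Rightarrow> nat set"
    assume "\<forall>v \<in> verts ?G. finite (L v) \<and> card (L v) = card (verts ?G)"
    then have "\<forall>v \<in> verts ?G. finite (L v) \<and> card (verts ?G) \<le> card (L v)"
      by simp
    from injective_choice[OF fin this] proper
    show "\<exists>c. (\<forall>v \<in> verts ?G. c v \<in> L v) \<and> proper_colouring ?G c"
      by blast
  qed
  then show ?thesis
    unfolding list_chromatic_number_def by (rule LeastI)
qed

end

theory Submission
  imports Defs "HOL-Library.FuncSet"
begin

text \<open>
  The bound is an instance of the general fact that a graph on \<open>m\<close> vertices with a proper colouring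
  \<open>f\<close> in \<open>N\<close> colours is \<open>k\<close>-choosable as soon as \<open>k > N * ln m\<close>.  To see this, label every list
  colour \<open>x\<close> independently and uniformly at random by one of the \<open>N\<close> colours of \<open>f\<close>, and let a
  vertex \<open>v\<close> use \<open>x\<close> only if the label of \<open>x\<close> is \<open>f v\<close>.  Vertices that use the same \<open>x\<close> then have
  the same colour under \<open>f\<close>, so they are not adjacent.  A vertex finds no usable colour in its list
  with probability \<open>(1 - 1/N)^k \<le> exp (- k / N) < 1 / m\<close>, and by the union bound some labelling
  serves all vertices at once (\<open>labelling_hitting_all_targets\<close>, \<open>choosable_if_proper_colouring\<close>).

  The graph \<open>G(n,r,s)\<close> has at most \<open>n^r\<close> vertices, and it is properly coloured by mapping each
  \<open>r\<close>-set to one of its \<open>(s+1)\<close>-subsets: two sets with the same image share more than \<open>s\<close> elements.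
  This takes at most \<open>n^(s+1)\<close> colours, so \<open>k\<close> slightly above \<open>r * n^(s+1) * ln n\<close> is enough.
\<close>

text \<open>The union bound, in counting form: among the \<open>N^|X|\<close> labellings of the set \<open>X\<close> of all list
  elements, those that miss the target \<open>f v\<close> on the whole of \<open>L v\<close> number
  \<open>(N - 1)^k * N^(|X| - k)\<close>.\<close>

lemma labelling_hitting_all_targets:
  fixes L :: "'a \<Rightarrow> 'c set" and f :: "'a \<Rightarrow> 'b"
  assumes "finite V" and "finite F" and "f ` V \<subseteq> F"
    and L: "\<And>v. v \<in> V \<Longrightarrow> finite (L v) \<and> card (L v) = k"
    and few: "card V * (card F - 1) ^ k < card F ^ k"
  shows "\<exists>T. \<forall>v\<in>V. \<exists>x\<in>L v. T x = f v"
proof (cases "V = {}")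
  case False
  define X where "X = (\<Union>v\<in>V. L v)"
  define missing where "missing v = (\<Pi>\<^sub>E x\<in>X. if x \<in> L v then F - {f v} else F)" for v
  have finX: "finite X"
    using assms by (auto simp: X_def)
  have "F \<noteq> {}"
    using False assms(3) by blast
  then have N_pos: "card F > 0"
    using \<open>finite F\<close> by (simp add: card_gt_0_iff)
  have kX: "k \<le> card X"
  proof -
    obtain v where "v \<in> V"
      using False by blast
    then show ?thesis
      using card_mono[OF finX, of "L v"] L[of v] by (auto simp: X_def)
  qed
  have card_missing: "card (missing v) = (card F - 1) ^ k * card F ^ (card X - k)" if v: "v \<in> V" for v
  proof -
    have sub: "L v \<subseteq> X"
      using v by (auto simp: X_def)
    have fv: "f v \<in> F"
      using v assms(3) by blast
    have "card (missing v) = (\<Prod>x\<in>X. if x \<in> L v then card F - 1 else card F)"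
      unfolding missing_def using finX fv by (simp add: card_PiE if_distrib cong: if_cong)
    also have "\<dots> = (card F - 1) ^ card (X \<inter> L v) * card F ^ card (X \<inter> - L v)"
      using finX by (simp add: prod.If_cases)
    also have "X \<inter> L v = L v"
      using sub by blast
    also have "X \<inter> - L v = X - L v"
      by blast
    also have "card (X - L v) = card X - k"
      using sub L[OF v] by (simp add: card_Diff_subset)
    finally show ?thesis
      using L[OF v] by simp
  qed
  have "\<not> (X \<rightarrow>\<^sub>E F) \<subseteq> (\<Union>v\<in>V. missing v)"
  proof
    assume sub: "(X \<rightarrow>\<^sub>E F) \<subseteq> (\<Union>v\<in>V. missing v)"
    have "finite (\<Union>v\<in>V. missing v)"
      using \<open>finite V\<close> \<open>finite F\<close> finX by (auto simp: missing_def intro!: finite_PiE)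
    then have "card (X \<rightarrow>\<^sub>E F) \<le> card (\<Union>v\<in>V. missing v)"
      using sub by (rule card_mono)
    also have "\<dots> \<le> (\<Sum>v\<in>V. card (missing v))"
      using \<open>finite V\<close> by (rule card_UN_le)
    also have "\<dots> = (card V * (card F - 1) ^ k) * card F ^ (card X - k)"
      by (simp add: card_missing)
    also have "\<dots> < card F ^ k * card F ^ (card X - k)"
      using few N_pos by simp
    also have "\<dots> = card F ^ card X"
      using kX by (simp flip: power_add)
    also have "\<dots> = card (X \<rightarrow>\<^sub>E F)"
      using finX by (simp add: card_PiE)
    finally show False
      by simp
  qed
  then obtain T where T: "T \<in> X \<rightarrow>\<^sub>E F" "\<And>v. v \<in> V \<Longrightarrow> T \<notin> missing v"
    by blast
  have "\<exists>x\<in>L v. T x = f v" if "v \<in> V" for v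
  proof (rule ccontr)
    assume "\<not> (\<exists>x\<in>L v. T x = f v)"
    then have "T \<in> missing v"
      using T(1) unfolding missing_def PiE_iff by simp
    then show False
      using T(2)[OF that] by contradiction
  qed
  then show ?thesis
    by blast
qed simp

text \<open>The list chromatic number exceeds the chromatic number at most by a factor of about
  \<open>ln |V|\<close>.  A labelling \<open>T\<close> of the list elements turns \<open>f\<close> into a list colouring: each vertex
  \<open>v\<close> takes an element of its list with label \<open>f v\<close>, so that \<open>f\<close> is a function of the colour
  chosen and properness is inherited.\<close>

lemma choosable_if_proper_colouring:
  assumes "finite (verts G)" and "finite F" and "f ` verts G \<subseteq> F"
    and "\<And>u v. {u, v} \<in> edges G \<Longrightarrow> u \<in> verts G \<and> v \<in> verts G"
    and "proper_colouring G f"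
    and k: "real (card F) * ln (real (card (verts G))) < real k"
  shows "choosable G k"
  unfolding choosable_def
proof (intro allI impI)
  fix L :: "'a \<Rightarrow> nat set"
  assume L: "\<forall>v \<in> verts G. finite (L v) \<and> card (L v) = k"
  let ?V = "verts G" and ?N = "card F"
  have "\<exists>T. \<forall>v\<in>?V. \<exists>x\<in>L v. T x = f v"
  proof (cases "?V = {}")
    case False
    then have m_pos: "card ?V > 0"
      using assms(1) by (simp add: card_gt_0_iff)
    have "F \<noteq> {}"
      using False assms(3) by blast
    then have N_pos: "?N > 0"
      using \<open>finite F\<close> by (simp add: card_gt_0_iff)
    have "real (?N - 1) = real ?N * (1 - 1 / real ?N)"
      using N_pos by (simp add: of_nat_diff field_simps)
    also have "\<dots> \<le> real ?N * exp (- 1 / real ?N)"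
      using exp_ge_add_one_self[of "- 1 / real ?N"] by (intro mult_left_mono) auto
    finally have "real (?N - 1) ^ k \<le> (real ?N * exp (- 1 / real ?N)) ^ k"
      by (intro power_mono) auto
    also have "\<dots> = real ?N ^ k * exp (- (real k / real ?N))"
      by (simp add: power_mult_distrib flip: exp_of_nat_mult)
    finally have miss: "real (?N - 1) ^ k \<le> real ?N ^ k * exp (- (real k / real ?N))" .
    have "ln (real (card ?V)) < real k / real ?N"
      using k N_pos by (simp add: field_simps)
    then have "real (card ?V) < exp (real k / real ?N)"
      using m_pos by (metis exp_less_mono exp_ln of_nat_0_less_iff)
    then have "real (card ?V) * exp (- (real k / real ?N)) < 1"
      by (simp add: exp_minus field_simps)
    then have "real ?N ^ k * (real (card ?V) * exp (- (real k / real ?N))) < real ?N ^ k"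
      using N_pos by simp
    moreover have "real (card ?V) * real (?N - 1) ^ k
        \<le> real (card ?V) * (real ?N ^ k * exp (- (real k / real ?N)))"
      using miss by (intro mult_left_mono) auto
    ultimately have "real (card ?V) * real (?N - 1) ^ k < real ?N ^ k"
      by (simp add: mult_ac)
    then have "card ?V * (?N - 1) ^ k < ?N ^ k"
      by (metis of_nat_less_iff of_nat_mult of_nat_power)
    with assms(1-3) L show ?thesis
      by (intro labelling_hitting_all_targets) auto
  qed simp
  then obtain T c where c: "\<And>v. v \<in> ?V \<Longrightarrow> c v \<in> L v" "\<And>v. v \<in> ?V \<Longrightarrow> T (c v) = f v"
    by metis
  have "proper_colouring G c"
    unfolding proper_colouring_def
  proof (intro allI impI notI)
    fix u v
    assume e: "{u, v} \<in> edges G" and "c u = c v"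
    then have "f u = f v"
      using c(2) assms(4)[OF e] by metis
    then show False
      using e assms(5) by (auto simp: proper_colouring_def)
  qed
  with c(1) show "\<exists>c. (\<forall>v \<in> ?V. c v \<in> L v) \<and> proper_colouring G c"
    by blast
qed

lemma card_subsets_of_size_le: "card {A. A \<subseteq> {1..n::nat} \<and> card A = j} \<le> n ^ j"
proof -
  have "n choose j \<le> n ^ j"
    using binomial_le_pow[of j n] by (cases "j \<le> n") (simp_all add: binomial_eq_0)
  then show ?thesis
    using n_subsets[of "{1..n}" j] by simp
qed

lemma choosable_intersection_graph:
  assumes "s < r" and "n > 0"
    and k: "real r * real n ^ (s + 1) * ln (real n) < real k"
  shows "choosable (intersection_graph n r s) k"
proof -
  let ?G = "intersection_graph n r s"
  let ?F = "{T. T \<subseteq> {1..n} \<and> card T = s + 1}"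
  have V: "verts ?G = {A. A \<subseteq> {1..n} \<and> card A = r}"
    by (simp add: verts_def intersection_graph_def)
  have E: "u \<in> verts ?G \<and> v \<in> verts ?G \<and> card (u \<inter> v) = s" if "{u, v} \<in> edges ?G" for u v
    using that by (auto simp: edges_def verts_def intersection_graph_def doubleton_eq_iff Int_commute)
  have "\<exists>T. T \<subseteq> A \<and> card T = s + 1" if "A \<in> verts ?G" for A
  proof -
    have "s + 1 \<le> card A"
      using that assms(1) by (simp add: V)
    then show ?thesis
      by (rule obtain_subset_with_card_n) blast
  qed
  then obtain f where f: "\<And>A. A \<in> verts ?G \<Longrightarrow> f A \<subseteq> A \<and> card (f A) = s + 1"
    by metis
  have "proper_colouring ?G f"
    unfolding proper_colouring_def
  proof (intro allI impI notI)
    fix u v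
    assume e: "{u, v} \<in> edges ?G" and "f u = f v"
    then have "f u \<subseteq> u \<inter> v" and "card (f u) = s + 1"
      using f E[OF e] by blast+
    moreover have "finite (u \<inter> v)"
      using E[OF e] by (auto simp: V intro: finite_subset)
    ultimately have "s + 1 \<le> card (u \<inter> v)"
      by (metis card_mono)
    then show False
      using E[OF e] by simp
  qed
  moreover have "f ` verts ?G \<subseteq> ?F"
  proof (rule image_subsetI)
    fix A
    assume A: "A \<in> verts ?G"
    then have "A \<subseteq> {1..n}"
      by (simp add: V)
    with f[OF A] show "f A \<in> ?F"
      by blast
  qed
  moreover have "real (card ?F) * ln (real (card (verts ?G))) < real k"
  proof -
    have ln_le: "ln (real (card (verts ?G))) \<le> real r * ln (real n)"
    proof (cases "card (verts ?G) = 0")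
      case False
      have "real (card (verts ?G)) \<le> real n ^ r"
        using card_subsets_of_size_le[of n r] unfolding V by (metis of_nat_le_iff of_nat_power)
      then have "ln (real (card (verts ?G))) \<le> ln (real n ^ r)"
        using False assms(2) by (subst ln_le_cancel_iff) auto
      then show ?thesis
        using assms(2) by (simp add: ln_realpow)
    qed (use assms(2) in simp)
    have F_le: "real (card ?F) \<le> real n ^ (s + 1)"
      using card_subsets_of_size_le[of n "s + 1"] by (metis of_nat_le_iff of_nat_power)
    have "0 \<le> real r * ln (real n)"
      using assms(2) by simp
    then have "real (card ?F) * (real r * ln (real n)) \<le> real n ^ (s + 1) * (real r * ln (real n))"
      using F_le by (intro mult_right_mono)
    moreover have "real (card ?F) * ln (real (card (verts ?G)))
        \<le> real (card ?F) * (real r * ln (real n))"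
      using ln_le by (intro mult_left_mono) simp_all
    moreover have "real n ^ (s + 1) * (real r * ln (real n)) < real k"
      using k by (simp only: mult_ac)
    ultimately show ?thesis
      by linarith
  qed
  ultimately show ?thesis
    using E by (intro choosable_if_proper_colouring[of _ ?F f]) (auto simp: V)
qed

theorem lemma1p3:
  fixes r s :: nat
  assumes "s < r"
  shows "(\<lambda>n. real (list_chromatic_number (intersection_graph n r s)))
           \<in> O(\<lambda>n. real n ^ (s + 1) * ln (real n))"
proof (rule bigoI[where c = "real r + 1"])
  show "\<forall>\<^sub>F n in sequentially. norm (real (list_chromatic_number (intersection_graph n r s)))
          \<le> (real r + 1) * norm (real n ^ (s + 1) * ln (real n))"
    using eventually_ge_at_top[of 3]
  proof eventually_elim
    case (elim n)
    let ?b = "real n ^ (s + 1) * ln (real n)"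
    \<comment> \<open>From \<open>n = 3 > e\<close> on, the rounding error in \<open>k\<close> is absorbed by one more copy of the bound.\<close>
    have "exp 1 \<le> real n"
      using exp_le elim by linarith
    then have "1 \<le> ln (real n)"
      using elim by (subst ln_ge_iff) auto
    moreover have "1 \<le> real n ^ (s + 1)"
      using elim by (intro one_le_power) auto
    ultimately have b: "1 \<le> ?b"
      using mult_mono[of 1 "real n ^ (s + 1)" 1 "ln (real n)"] by simp
    define k where "k = nat \<lfloor>real r * ?b\<rfloor> + 1"
    have "0 \<le> ?b"
      using b by linarith
    then have rb: "0 \<le> real r * ?b"
      by (rule mult_nonneg_nonneg[OF of_nat_0_le_iff])
    have "real r * ?b < real k" and k_le: "real k \<le> real r * ?b + 1"
      using rb unfolding k_def by linarith+
    then have "choosable (intersection_graph n r s) k"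
      using assms elim by (intro choosable_intersection_graph) (auto simp: mult.assoc)
    then have "list_chromatic_number (intersection_graph n r s) \<le> k"
      unfolding list_chromatic_number_def by (rule Least_le)
    then have "real (list_chromatic_number (intersection_graph n r s)) \<le> real r * ?b + ?b"
      using k_le b by linarith
    then show ?case
      using b by (simp add: distrib_right)
  qed
qed

end
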